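(* Let $X$ be a proper geodesic metric space. Then $\partial_c^{\mathcal{FQ}}X$ is Hausdorff.
   Context: A function $\rho\colon[0,\infty)\to\mathbb{R}$ is sublinear if it is non-decreasing, eventually non-negative, and $\lim_{r\to\infty}\rho(r)/r=0$. Let $X$ be a proper geodesic metric space with metric $d$. For a closed subset $Z\subset X$ let $\pi_Z(x):=\{z\in Z\mid d(x,z)=d(x,Z)\}$. For sublinear $\rho$, $Z$ is $\rho$-contracting if for all $x,y\in X$: $d(x,y)\le d(x,Z)$ implies $\operatorname{diam}(\pi_Z(x)\cup\pi_Z(y))\le\rho(d(x,Z))$. $Z$ is contracting if it is $\rho$-contracting for some sublinear $\rho$. A geodesic is an isometric embedding of an interval. For $L\ge1$, $A\ge0$, an $(L,A)$-quasi-geodesic is a map $\gamma$ from an interval with $\frac1L|s-t|-A\le d(\gamma(s),\gamma(t))\le L|s-t|+A$ for all $s,t$; a ray has domain $[0,\infty)$. Quasi-geodesics are conflated with their images, and a quasi-geodesic is contracting if its image is. Fix a basepoint $o\in X$. $\partial_cX$ is the set of contracting quasi-geodesic rays based at $o$ modulo finite Hausdorff distance. Every $\zeta\in\partial_cX$ contains a geodesic ray based at $o$; the function $\rho_\zeta(r):=\sup\operatorname{diam}(\pi_\alpha(x)\cup\pi_\alpha(y))$, with supremum over geodesic rays $\alpha\in\zeta$ (based at $o$) and points $x,y$ with $d(x,y)\le d(x,\alpha)\le r$, is sublinear and every geodesic in $\zeta$ is $\rho_\zeta$-contracting. For each $\zeta$ fix a geodesic ray $\alpha^\zeta\in\zeta$.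 For sublinear $\rho$, $L\ge1$, $A\ge0$ set $\kappa(\rho,L,A):=\max\{3A,\,3L^2,\,1+\inf\{R>0\mid\forall r\ge R,\ 3L^2\rho(r)\le r\}\}$. For $r\ge1$, $U(\zeta,r)$ is the set of $\eta\in\partial_cX$ such that for all $L\ge1$, $A\ge0$ and every continuous $(L,A)$-quasi-geodesic ray $\beta\in\eta$ (based at $o$) we have $d(\beta,\{x\in\alpha^\zeta\mid d(x,o)\ge r\})\le\kappa(\rho_\zeta,L,A)$. The topology of fellow-travelling quasi-geodesics is $\mathcal{FQ}:=\{U\subset\partial_cX\mid\forall\zeta\in U\ \exists r\ge1,\ U(\zeta,r)\subset U\}$, and $\partial_c^{\mathcal{FQ}}X$ is $\partial_cX$ with this topology. *)

theory Defs
  imports "HOL-Analysis.Analysis"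
begin

section \<open>Geodesics and quasi-geodesics\<close>

text \<open>
  Paths are total functions on the reals of which only the values on the interval \<open>I\<close> matter;
  rays have domain \<open>{0..}\<close>.
\<close>

definition geodesic :: "real set \<Rightarrow> (real \<Rightarrow> 'a::metric_space) \<Rightarrow> bool" where
  "geodesic I \<gamma> \<longleftrightarrow> is_interval I \<and> (\<forall>s\<in>I. \<forall>t\<in>I. dist (\<gamma> s) (\<gamma> t) = \<bar>s - t\<bar>)"

definition geodesic_space :: "'a::metric_space itself \<Rightarrow> bool" where
  "geodesic_space _ \<longleftrightarrow>
     (\<forall>x y :: 'a. \<exists>\<gamma>. geodesic {0..dist x y} \<gamma> \<and> \<gamma> 0 = x \<and> \<gamma> (dist x y) = y)"

definition quasi_geodesic :: "real \<Rightarrow> real \<Rightarrow> real set \<Rightarrow> (real \<Rightarrow> 'a::metric_space) \<Rightarrow> bool" where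
  "quasi_geodesic L A I \<gamma> \<longleftrightarrow> L \<ge> 1 \<and> A \<ge> 0 \<and> is_interval I \<and>
     (\<forall>s\<in>I. \<forall>t\<in>I. 1 / L * \<bar>s - t\<bar> - A \<le> dist (\<gamma> s) (\<gamma> t) \<and>
                  dist (\<gamma> s) (\<gamma> t) \<le> L * \<bar>s - t\<bar> + A)"

abbreviation ray_image :: "(real \<Rightarrow> 'a) \<Rightarrow> 'a set" where
  "ray_image \<gamma> \<equiv> \<gamma> ` {0..}"


section \<open>Contracting sets\<close>

definition sublinear :: "(real \<Rightarrow> real) \<Rightarrow> bool" where
  "sublinear \<rho> \<longleftrightarrow> mono_on {0..} \<rho> \<and> (\<forall>\<^sub>F r in at_top. 0 \<le> \<rho> r) \<and>
     ((\<lambda>r. \<rho> r / r) \<longlongrightarrow> 0) at_top"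

definition closest_points :: "'a::metric_space set \<Rightarrow> 'a \<Rightarrow> 'a set" where
  "closest_points Z x = {z \<in> Z. dist x z = infdist x Z}"

definition rho_contracting :: "(real \<Rightarrow> real) \<Rightarrow> 'a::metric_space set \<Rightarrow> bool" where
  "rho_contracting \<rho> Z \<longleftrightarrow>
     (\<forall>x y. dist x y \<le> infdist x Z \<longrightarrow>
        diameter (closest_points Z x \<union> closest_points Z y) \<le> \<rho> (infdist x Z))"

text \<open>
  The notion is only meant for closed sets. The image of a discontinuous quasi-geodesic need not
  be closed; for such images \<^const>\<open>closest_points\<close> may be empty and the contraction
  inequality vacuous, so closedness is part of the definition.
\<close>

definition contracting :: "'a::metric_space set \<Rightarrow> bool" where
  "contracting Z \<longleftrightarrow> closed Z \<and> (\<exists>\<rho>. sublinear \<rho> \<and> rho_contracting \<rho> Z)"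


section \<open>The contracting boundary\<close>

definition finite_Hausdorff_distance :: "'a::metric_space set \<Rightarrow> 'a set \<Rightarrow> bool" where
  "finite_Hausdorff_distance S T \<longleftrightarrow>
     (\<exists>C. (\<forall>x\<in>S. \<exists>y\<in>T. dist x y \<le> C) \<and> (\<forall>y\<in>T. \<exists>x\<in>S. dist y x \<le> C))"

definition contracting_rays :: "'a::metric_space \<Rightarrow> (real \<Rightarrow> 'a) set" where
  "contracting_rays p =
     {\<gamma>. (\<exists>L A. quasi_geodesic L A {0..} \<gamma>) \<and> \<gamma> 0 = p \<and> contracting (ray_image \<gamma>)}"

definition asymptotic_rel :: "'a::metric_space \<Rightarrow> ((real \<Rightarrow> 'a) \<times> (real \<Rightarrow> 'a)) set" where
  "asymptotic_rel p = {(\<beta>, \<gamma>). \<beta> \<in> contracting_rays p \<and> \<gamma> \<in> contracting_rays p \<and>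
     finite_Hausdorff_distance (ray_image \<beta>) (ray_image \<gamma>)}"

definition contracting_boundary :: "'a::metric_space \<Rightarrow> (real \<Rightarrow> 'a) set set" where
  "contracting_boundary p = contracting_rays p // asymptotic_rel p"

lemma equiv_asymptotic_rel: "equiv (contracting_rays p) (asymptotic_rel p)"
proof (rule equivI)
  show "asymptotic_rel p \<subseteq> contracting_rays p \<times> contracting_rays p"
    by (auto simp: asymptotic_rel_def)
  show "refl_on (contracting_rays p) (asymptotic_rel p)"
    unfolding refl_on_def asymptotic_rel_def finite_Hausdorff_distance_def
    by (auto intro!: exI[of _ 0])
  show "sym (asymptotic_rel p)"
    unfolding sym_def asymptotic_rel_def finite_Hausdorff_distance_def by auto
  show "trans (asymptotic_rel p)"
  proof (rule transI)
    fix \<alpha> \<beta> \<gamma>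
    assume 1: "(\<alpha>, \<beta>) \<in> asymptotic_rel p" and 2: "(\<beta>, \<gamma>) \<in> asymptotic_rel p"
    have tri: "\<forall>x\<in>S. \<exists>z\<in>V. dist x z \<le> C + D"
      if "\<forall>x\<in>S. \<exists>y\<in>T. dist x y \<le> C" "\<forall>y\<in>T. \<exists>z\<in>V. dist y z \<le> D"
      for S T V :: "'a set" and C D :: real
    proof
      fix x assume "x \<in> S"
      with that obtain y z where "y \<in> T" "dist x y \<le> C" "z \<in> V" "dist y z \<le> D" by meson
      then show "\<exists>z\<in>V. dist x z \<le> C + D"
        using dist_triangle[of x z y] by (intro bexI[of _ z]) auto
    qed
    obtain C where C: "\<forall>x\<in>ray_image \<alpha>. \<exists>y\<in>ray_image \<beta>. dist x y \<le> C"
        "\<forall>y\<in>ray_image \<beta>. \<exists>x\<in>ray_image \<alpha>. dist y x \<le> C"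
      using 1 unfolding asymptotic_rel_def finite_Hausdorff_distance_def by blast
    obtain D where D: "\<forall>x\<in>ray_image \<beta>. \<exists>y\<in>ray_image \<gamma>. dist x y \<le> D"
        "\<forall>y\<in>ray_image \<gamma>. \<exists>x\<in>ray_image \<beta>. dist y x \<le> D"
      using 2 unfolding asymptotic_rel_def finite_Hausdorff_distance_def by blast
    have "finite_Hausdorff_distance (ray_image \<alpha>) (ray_image \<gamma>)"
      unfolding finite_Hausdorff_distance_def
      using tri[OF C(1) D(1)] tri[OF D(2) C(2)] by (auto simp: add.commute intro!: exI[of _ "C + D"])
    with 1 2 show "(\<alpha>, \<gamma>) \<in> asymptotic_rel p"
      unfolding asymptotic_rel_def by auto
  qed
qed


section \<open>The topology of fellow-travelling quasi-geodesics\<close>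

text \<open>
  The supremum is a supremum of real numbers. For \<open>\<zeta>\<close> in the contracting boundary of a proper
  geodesic space and \<open>r \<ge> 0\<close> the set is nonempty and bounded above.
\<close>

definition rho_of :: "(real \<Rightarrow> 'a::metric_space) set \<Rightarrow> real \<Rightarrow> real" where
  "rho_of \<zeta> r = Sup {diameter (closest_points (ray_image \<alpha>) x \<union> closest_points (ray_image \<alpha>) y) |
     \<alpha> x y. \<alpha> \<in> \<zeta> \<and> geodesic {0..} \<alpha> \<and>
            dist x y \<le> infdist x (ray_image \<alpha>) \<and> infdist x (ray_image \<alpha>) \<le> r}"

definition kappa :: "(real \<Rightarrow> real) \<Rightarrow> real \<Rightarrow> real \<Rightarrow> real" where
  "kappa \<rho> L A = Max {3 * A, 3 * L\<^sup>2, 1 + Inf {R. R > 0 \<and> (\<forall>r\<ge>R. 3 * L\<^sup>2 * \<rho> r \<le> r)}}"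

text \<open>A choice of a geodesic representative in each class; it is based at \<open>p\<close>, as is every
  element of a class.\<close>

definition geodesic_choice ::
  "'a::metric_space \<Rightarrow> ((real \<Rightarrow> 'a) set \<Rightarrow> (real \<Rightarrow> 'a)) \<Rightarrow> bool" where
  "geodesic_choice p \<alpha> \<longleftrightarrow> (\<forall>\<zeta>\<in>contracting_boundary p. \<alpha> \<zeta> \<in> \<zeta> \<and> geodesic {0..} (\<alpha> \<zeta>))"

definition FQ_nbhd :: "'a::metric_space \<Rightarrow> ((real \<Rightarrow> 'a) set \<Rightarrow> (real \<Rightarrow> 'a)) \<Rightarrow>
    (real \<Rightarrow> 'a) set \<Rightarrow> real \<Rightarrow> (real \<Rightarrow> 'a) set set" where
  "FQ_nbhd p \<alpha> \<zeta> r = {\<eta> \<in> contracting_boundary p.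
     \<forall>L\<ge>1. \<forall>A\<ge>0. \<forall>\<beta>\<in>\<eta>. continuous_on {0..} \<beta> \<and> quasi_geodesic L A {0..} \<beta> \<longrightarrow>
       setdist (ray_image \<beta>) {x \<in> ray_image (\<alpha> \<zeta>). dist x p \<ge> r} \<le> kappa (rho_of \<zeta>) L A}"

definition FQ_open :: "'a::metric_space \<Rightarrow> ((real \<Rightarrow> 'a) set \<Rightarrow> (real \<Rightarrow> 'a)) \<Rightarrow>
    (real \<Rightarrow> 'a) set set \<Rightarrow> bool" where
  "FQ_open p \<alpha> U \<longleftrightarrow> U \<subseteq> contracting_boundary p \<and> (\<forall>\<zeta>\<in>U. \<exists>r\<ge>1. FQ_nbhd p \<alpha> \<zeta> r \<subseteq> U)"

definition FQ_topology :: "'a::metric_space \<Rightarrow> ((real \<Rightarrow> 'a) set \<Rightarrow> (real \<Rightarrow> 'a)) \<Rightarrow>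
    (real \<Rightarrow> 'a) set topology" where
  "FQ_topology p \<alpha> = topology (FQ_open p \<alpha>)"

lemma based_at_basepoint:
  assumes "\<zeta> \<in> contracting_boundary p" "\<gamma> \<in> \<zeta>"
  shows "\<gamma> 0 = p"
  using assms
  by (auto simp: contracting_boundary_def quotient_def asymptotic_rel_def contracting_rays_def)

lemma FQ_nbhd_antimono:
  assumes \<alpha>: "geodesic_choice p \<alpha>" and \<zeta>: "\<zeta> \<in> contracting_boundary p" and "1 \<le> r" "r \<le> s"
  shows "FQ_nbhd p \<alpha> \<zeta> s \<subseteq> FQ_nbhd p \<alpha> \<zeta> r"
proof -
  have g: "geodesic {0..} (\<alpha> \<zeta>)" and "\<alpha> \<zeta> 0 = p"
    using \<alpha> \<zeta> based_at_basepoint unfolding geodesic_choice_def by blast+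
  then have "dist (\<alpha> \<zeta> s) p = s"
    using assms(3,4) unfolding geodesic_def by force
  then have ne: "{x \<in> ray_image (\<alpha> \<zeta>). dist x p \<ge> s} \<noteq> {}"
    using assms(3,4) by (auto intro!: bexI[of _ s])
  have "setdist B {x \<in> ray_image (\<alpha> \<zeta>). dist x p \<ge> r}
      \<le> setdist B {x \<in> ray_image (\<alpha> \<zeta>). dist x p \<ge> s}" for B
    using ne assms(4) by (intro setdist_subset_right) auto
  then show ?thesis
    unfolding FQ_nbhd_def by (blast intro: order_trans)
qed

lemma istopology_FQ_open:
  assumes \<alpha>: "geodesic_choice p \<alpha>"
  shows "istopology (FQ_open p \<alpha>)"
  unfolding istopology_def
proof (intro conjI allI impI)
  fix S T assume S: "FQ_open p \<alpha> S" and T: "FQ_open p \<alpha> T"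
  show "FQ_open p \<alpha> (S \<inter> T)"
    unfolding FQ_open_def
  proof (intro conjI ballI)
    show "S \<inter> T \<subseteq> contracting_boundary p" using S unfolding FQ_open_def by blast
    fix \<zeta> assume \<zeta>: "\<zeta> \<in> S \<inter> T"
    then have mem: "\<zeta> \<in> contracting_boundary p" using S unfolding FQ_open_def by blast
    obtain r where r: "r \<ge> 1" "FQ_nbhd p \<alpha> \<zeta> r \<subseteq> S"
      using S \<zeta> unfolding FQ_open_def by blast
    obtain s where s: "s \<ge> 1" "FQ_nbhd p \<alpha> \<zeta> s \<subseteq> T"
      using T \<zeta> unfolding FQ_open_def by blast
    have "FQ_nbhd p \<alpha> \<zeta> (max r s) \<subseteq> S \<inter> T"
      using FQ_nbhd_antimono[OF \<alpha> mem r(1), of "max r s"]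
        FQ_nbhd_antimono[OF \<alpha> mem s(1), of "max r s"] r s by auto
    then show "\<exists>r\<ge>1. FQ_nbhd p \<alpha> \<zeta> r \<subseteq> S \<inter> T"
      using r(1) by (intro exI[of _ "max r s"]) auto
  qed
next
  fix \<K> assume K: "\<forall>S\<in>\<K>. FQ_open p \<alpha> S"
  show "FQ_open p \<alpha> (\<Union>\<K>)"
    unfolding FQ_open_def
  proof (intro conjI ballI)
    show "\<Union>\<K> \<subseteq> contracting_boundary p" using K unfolding FQ_open_def by blast
    fix \<zeta> assume "\<zeta> \<in> \<Union>\<K>"
    then obtain S where S: "S \<in> \<K>" "\<zeta> \<in> S" by blast
    then obtain r where "r \<ge> 1" "FQ_nbhd p \<alpha> \<zeta> r \<subseteq> S"
      using K unfolding FQ_open_def by blast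
    with S(1) show "\<exists>r\<ge>1. FQ_nbhd p \<alpha> \<zeta> r \<subseteq> \<Union>\<K>" by blast
  qed
qed

lemma openin_FQ_topology:
  "geodesic_choice p \<alpha> \<Longrightarrow> openin (FQ_topology p \<alpha>) U \<longleftrightarrow> FQ_open p \<alpha> U"
  by (simp add: FQ_topology_def topology_inverse' istopology_FQ_open)

lemma topspace_FQ_topology:
  assumes "geodesic_choice p \<alpha>"
  shows "topspace (FQ_topology p \<alpha>) = contracting_boundary p"
proof -
  have "FQ_open p \<alpha> (contracting_boundary p)"
    unfolding FQ_open_def FQ_nbhd_def by (auto intro!: exI[of _ 1])
  then show ?thesis
    unfolding topspace_def openin_FQ_topology[OF assms] by (auto simp: FQ_open_def)
qed

end

theory Submission
  imports Defs "HOL-Real_Asymp.Real_Asymp"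
begin

text \<open>
  For every open \<open>W \<subseteq> X\<close>, the set of classes all of whose geodesic rays meet \<open>W\<close> is open: if classes
  converging to \<open>\<eta>\<close> contained geodesic rays missing \<open>W\<close>, a limit of these rays would stay close to the
  geodesic representative of \<open>\<eta>\<close>, hence be contracting and belong to \<open>\<eta>\<close>, and it would miss \<open>W\<close>.
  Two classes are separated by taking for \<open>W\<close> neighbourhoods of far tails of their geodesic
  representatives: a geodesic ray that comes close to such a tail follows the representative up to
  there, and the two representatives diverge. Only geodesics are used, and it is irrelevant which
  finite value \<^const>\<open>kappa\<close> takes.
\<close>

section \<open>Projections to contracting sets\<close>

lemma sublinear_eventually_le:
  assumes "sublinear \<rho>" "\<epsilon> > 0"
  shows "\<exists>\<kappa>>0. \<forall>r\<ge>\<kappa>. \<rho> r \<le> \<epsilon> * r"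
proof -
  have "\<forall>\<^sub>F r in at_top. \<rho> r / r < \<epsilon>"
    using assms unfolding sublinear_def by (auto dest: order_tendstoD(2))
  then obtain N where N: "\<And>r. r \<ge> N \<Longrightarrow> \<rho> r / r < \<epsilon>"
    by (auto simp: eventually_at_top_linorder)
  have "\<rho> r \<le> \<epsilon> * r" if "r \<ge> max N 1" for r
    using N[of r] that by (simp add: field_simps)
  then show ?thesis
    by (intro exI[of _ "max N 1"]) simp
qed

text \<open>\<open>diameter\<close> is a supremum of reals, which dominates the individual distances
  once the set is bounded.\<close>

lemma bounded_closest_points: "bounded (closest_points Z x)"
  by (rule bounded_subset[OF bounded_cball[of x "infdist x Z"]])
    (auto simp: closest_points_def)

lemma closest_points_nonempty:
  fixes x :: "'a::heine_borel"
  assumes "closed Z" "Z \<noteq> {}"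
  obtains u where "u \<in> closest_points Z x"
proof -
  obtain u where "u \<in> Z" "infdist x Z = dist x u"
    by (rule infdist_attains_inf[OF assms])
  then show thesis by (intro that[of u]) (simp add: closest_points_def)
qed

lemma rho_contractingD:
  assumes "rho_contracting \<rho> Z" "dist x y \<le> infdist x Z"
    "u \<in> closest_points Z x" "v \<in> closest_points Z y"
  shows "dist u v \<le> \<rho> (infdist x Z)"
proof -
  have "dist u v \<le> diameter (closest_points Z x \<union> closest_points Z y)"
    using assms(3,4) by (intro diameter_bounded_bound) (auto simp: bounded_closest_points)
  also have "\<dots> \<le> \<rho> (infdist x Z)"
    using assms(1,2) by (simp add: rho_contracting_def)
  finally show ?thesis .
qed

text \<open>Step along the path by its current distance from \<open>Z\<close>: each step moves the projection by at
  most an eighth of its length.\<close>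

lemma projection_of_distant_path:
  fixes c :: "real \<Rightarrow> 'a::heine_borel"
  assumes Z: "closed Z" "Z \<noteq> {}" "rho_contracting \<rho> Z"
    and \<kappa>: "\<kappa> > 0" "\<And>r. r \<ge> \<kappa> \<Longrightarrow> \<rho> r \<le> r / 8"
    and far: "\<And>s. s \<in> {a..b} \<Longrightarrow> \<kappa> \<le> infdist (c s) Z"
    and lip: "\<And>s t. s \<in> {a..b} \<Longrightarrow> t \<in> {a..b} \<Longrightarrow> dist (c s) (c t) \<le> \<bar>s - t\<bar>"
    and "a \<le> b" "u \<in> closest_points Z (c a)" "v \<in> closest_points Z (c b)"
  shows "dist u v \<le> (b - a) / 4 + infdist (c b) Z / 8"
proof -
  \<comment> \<open>Every full step has length at least \<open>\<kappa>\<close>, so \<open>n\<close>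
    bounds their number; the induction moves the start \<open>a\<close> and its projection
    \<open>u\<close> along.\<close>
  obtain n where "b - a \<le> of_nat n * \<kappa>"
    using \<kappa>(1) by (metis ex_less_of_nat_mult less_imp_le)
  then show ?thesis
    using far lip assms(8-9)
  proof (induction n arbitrary: a u)
    case 0
    then have "a = b" by simp
    \<comment> \<open>Even here \<open>u\<close> and \<open>v\<close> may be different closest
      points of the same point, hence the summand \<open>infdist (c b) Z / 8\<close>.\<close>
    have "dist u v \<le> \<rho> (infdist (c a) Z)"
      by (rule rho_contractingD[OF Z(3), of "c a" "c b"])
        (use \<open>a = b\<close> 0 assms(10) in \<open>auto simp: infdist_nonneg\<close>)
    also have "\<dots> \<le> infdist (c a) Z / 8"
      using 0 by (intro \<kappa>(2)) auto
    finally show ?case using \<open>a = b\<close> by simp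
  next
    case (Suc n)
    define h where "h = infdist (c a) Z"
    have h: "\<kappa> \<le> h" "\<rho> h \<le> h / 8"
      using Suc.prems \<kappa>(2) by (auto simp: h_def)
    show ?case
    proof (cases "b - a \<le> h")
      case True
      have "dist u v \<le> \<rho> h"
        unfolding h_def
        by (rule rho_contractingD[OF Z(3), of "c a" "c b"])
          (use True Suc.prems(3)[of a b] Suc.prems assms(10) in \<open>auto simp: h_def\<close>)
      \<comment> \<open>In the last step this splits \<open>h / 8\<close> between the two summands
        of the bound.\<close>
      moreover have "h \<le> infdist (c b) Z + (b - a)"
        using infdist_triangle[of "c a" Z "c b"] Suc.prems(3)[of a b] Suc.prems(4)
        by (auto simp: h_def)
      ultimately show ?thesis using h Suc.prems(4) by (simp add: field_simps)
    next
      case False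
      let ?a = "a + h"
      obtain w where w: "w \<in> closest_points Z (c ?a)"
        using closest_points_nonempty Z(1,2) by blast
      have "dist (c a) (c ?a) \<le> h"
        using False h \<kappa>(1) Suc.prems(3)[of a ?a] Suc.prems(4) by simp
      then have "dist u w \<le> \<rho> h"
        using rho_contractingD[OF Z(3) _ Suc.prems(5) w] by (simp add: h_def)
      moreover have "dist w v \<le> (b - ?a) / 4 + infdist (c b) Z / 8"
        using False h \<kappa>(1) w Suc.prems by (intro Suc.IH) (auto simp: algebra_simps)
      ultimately show ?thesis
        using dist_triangle[of u v w] h \<kappa>(1) by (simp add: field_simps)
    qed
  qed
qed

text \<open>With end distances \<open>x\<close> and \<open>y\<close>, the route through the two
  projections has length at most \<open>x + (b - a) / 4 + y / 8 + y\<close>. Since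
  \<open>b - a\<close> is the distance of the endpoints, the quarter can be absorbed on the
  left.\<close>

lemma distant_geodesic_length:
  fixes \<gamma> :: "real \<Rightarrow> 'a::heine_borel"
  assumes Z: "closed Z" "Z \<noteq> {}" "rho_contracting \<rho> Z"
    and \<kappa>: "\<kappa> > 0" "\<And>r. r \<ge> \<kappa> \<Longrightarrow> \<rho> r \<le> r / 8"
    and far: "\<And>s. s \<in> {a..b} \<Longrightarrow> \<kappa> \<le> infdist (\<gamma> s) Z"
    and \<gamma>: "geodesic {a..b} \<gamma>" and "a \<le> b"
  shows "b - a \<le> 2 * (infdist (\<gamma> a) Z + infdist (\<gamma> b) Z)"
proof -
  obtain u v where uv: "u \<in> closest_points Z (\<gamma> a)" "v \<in> closest_points Z (\<gamma> b)"
    using closest_points_nonempty Z(1,2) by metis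
  have "dist u v \<le> (b - a) / 4 + infdist (\<gamma> b) Z / 8"
    using \<gamma> by (intro projection_of_distant_path[OF Z \<kappa> far _ \<open>a \<le> b\<close> uv]) (auto simp: geodesic_def)
  moreover have "dist (\<gamma> a) (\<gamma> b) = b - a"
    using \<gamma> \<open>a \<le> b\<close> by (auto simp: geodesic_def)
  moreover have "dist (\<gamma> a) (\<gamma> b) \<le> dist (\<gamma> a) u + dist u v + dist (\<gamma> b) v"
    using dist_triangle[of "\<gamma> a" "\<gamma> b" u] dist_triangle[of u "\<gamma> b" v]
    by (simp add: dist_commute)
  moreover have "dist (\<gamma> a) u = infdist (\<gamma> a) Z" "dist (\<gamma> b) v = infdist (\<gamma> b) Z"
    using uv by (simp_all add: closest_points_def)
  ultimately show ?thesis
    using infdist_nonneg[of "\<gamma> a" Z] infdist_nonneg[of "\<gamma> b" Z]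
    by (simp add: field_simps)
qed

lemma geodesic_subset: "geodesic I \<gamma> \<Longrightarrow> J \<subseteq> I \<Longrightarrow> is_interval J \<Longrightarrow> geodesic J \<gamma>"
  unfolding geodesic_def by blast

lemma geodesic_continuous_on:
  assumes "geodesic I \<gamma>" shows "continuous_on I \<gamma>"
  unfolding continuous_on_iff
proof (intro ballI allI impI)
  fix x and e :: real assume "x \<in> I" "0 < e"
  then show "\<exists>d>0. \<forall>y\<in>I. dist y x < d \<longrightarrow> dist (\<gamma> y) (\<gamma> x) < e"
    using assms by (auto simp: geodesic_def dist_real_def intro!: exI[of _ e])
qed

section \<open>Geodesics from a contracting ray\<close>

text \<open>The largest time \<open>a\<close> in the compact set where \<open>h\<close> is at most
  \<open>k\<close> works: the intermediate value theorem yields a time of level \<open>k\<close> at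
  or after \<open>a\<close>, which by maximality is \<open>a\<close>.\<close>

lemma last_time_below:
  fixes h :: "real \<Rightarrow> real"
  assumes h: "continuous_on {x..y} h" and "x \<le> y" "h x \<le> k" "k \<le> h y"
  obtains a where "a \<in> {x..y}" "h a = k" "\<And>s. s \<in> {a..y} \<Longrightarrow> k \<le> h s"
proof -
  define S where "S = {x..y} \<inter> h -` {..k}"
  have "compact S"
    unfolding S_def compact_eq_bounded_closed
    by (auto intro: continuous_closed_preimage[OF h] bounded_Int)
  moreover have "x \<in> S" using assms by (auto simp: S_def)
  ultimately obtain a where a: "a \<in> S" "\<And>s. s \<in> S \<Longrightarrow> s \<le> a"
    using compact_attains_sup[of S] by blast
  then have axy: "x \<le> a" "a \<le> y" "h a \<le> k" by (auto simp: S_def)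
  then obtain a' where "a \<le> a'" "a' \<le> y" "h a' = k"
    using IVT'[of h a k y] \<open>k \<le> h y\<close> continuous_on_subset[OF h, of "{a..y}"] by auto
  moreover from this axy have "a' \<in> S" by (auto simp: S_def)
  ultimately have "h a = k" using a(2)[of a'] by simp
  moreover have "k \<le> h s" if "s \<in> {a..y}" for s
  proof (rule ccontr)
    assume "\<not> k \<le> h s"
    with that axy have "s \<in> S" by (auto simp: S_def)
    then have "s = a" using a(2) that by fastforce
    with \<open>h a = k\<close> \<open>\<not> k \<le> h s\<close> show False by simp
  qed
  ultimately show thesis using axy by (intro that[of a]) auto
qed

text \<open>Time reversal of \<open>last_time_below\<close>.\<close>

lemma first_time_below:
  fixes h :: "real \<Rightarrow> real"
  assumes h: "continuous_on {x..y} h" and "x \<le> y" "k \<le> h x" "h y \<le> k"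
  obtains b where "b \<in> {x..y}" "h b = k" "\<And>s. s \<in> {x..b} \<Longrightarrow> k \<le> h s"
proof -
  have "continuous_on {-y..-x} (\<lambda>s. h (- s))"
    by (intro continuous_on_compose2[OF h]) (auto intro: continuous_intros)
  then obtain a where a: "a \<in> {-y..-x}" "h (- a) = k" "\<And>s. s \<in> {a..-x} \<Longrightarrow> k \<le> h (- s)"
    by (rule last_time_below[where k = k]) (use assms in auto)
  show thesis
  proof (rule that[of "- a"])
    show "k \<le> h s" if "s \<in> {x..- a}" for s
      using a(3)[of "- s"] that by auto
  qed (use a in auto)
qed

text \<open>An excursion away from \<open>Z\<close> that starts and ends at distance
  \<open>\<kappa>\<close> is short by \<open>distant_geodesic_length\<close>, so it cannot get far;
  the margin between \<open>u\<close> and \<open>T\<close> ensures that the excursion through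
  \<open>u\<close> ends before \<open>T\<close>.\<close>

lemma geodesic_near_contracting_set:
  fixes \<gamma> :: "real \<Rightarrow> 'a::heine_borel"
  assumes Z: "closed Z" "Z \<noteq> {}" "rho_contracting \<rho> Z"
    and \<kappa>: "\<kappa> > 0" "\<And>r. r \<ge> \<kappa> \<Longrightarrow> \<rho> r \<le> r / 8"
    and \<gamma>: "geodesic {0..T} \<gamma>" and "\<gamma> 0 \<in> Z"
    and u: "0 \<le> u" "u + 2 * (\<kappa> + infdist (\<gamma> T) Z) < T"
  shows "infdist (\<gamma> u) Z \<le> 5 * \<kappa>"
proof (rule ccontr)
  assume far: "\<not> ?thesis"
  define h where "h s = infdist (\<gamma> s) Z" for s
  have hu: "h u > 5 * \<kappa>" using far by (simp add: h_def)
  have uT: "u \<le> T" using u infdist_nonneg[of "\<gamma> T" Z] \<kappa>(1) by simp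
  have cont: "continuous_on {0..T} h"
    unfolding h_def by (intro continuous_on_infdist geodesic_continuous_on[OF \<gamma>])
  have "h 0 \<le> \<kappa>"
    using \<kappa>(1) \<open>\<gamma> 0 \<in> Z\<close> by (simp add: h_def)
  moreover have "\<kappa> \<le> h u" using hu \<kappa>(1) by simp
  moreover have "continuous_on {0..u} h"
    using uT by (intro continuous_on_subset[OF cont]) auto
  ultimately obtain a where a: "a \<in> {0..u}" "h a = \<kappa>" "\<And>s. s \<in> {a..u} \<Longrightarrow> \<kappa> \<le> h s"
    using last_time_below[of 0 u h \<kappa>] u(1) by blast
  \<comment> \<open>Applied twice below: with \<open>b = T\<close>, to show that the geodesic comes
    back, and with the time of return.\<close>
  have length: "b - a \<le> 2 * (\<kappa> + h b)"
    if b: "u \<le> b" "b \<le> T" and hb: "\<And>s. s \<in> {u..b} \<Longrightarrow> \<kappa> \<le> h s" for b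
  proof -
    have "\<kappa> \<le> infdist (\<gamma> s) Z" if "s \<in> {a..b}" for s
      using a(3)[of s] that hb[of s] by (cases "s \<le> u") (auto simp: h_def)
    moreover have "geodesic {a..b} \<gamma>"
      using a(1) b by (intro geodesic_subset[OF \<gamma>]) (auto simp: is_interval_cc)
    ultimately show ?thesis
      using distant_geodesic_length[OF Z \<kappa>, of a b \<gamma>] a(1,2) b(1) by (simp add: h_def)
  qed
  \<comment> \<open>Staying far up to \<open>T\<close> contradicts the margin assumed for
    \<open>u\<close>, because \<open>a \<le> u\<close>.\<close>
  have "\<not> T - a \<le> 2 * (\<kappa> + h T)"
    using u a(1) by (simp add: h_def)
  then obtain s where s: "s \<in> {u..T}" "h s < \<kappa>"
    using length[OF uT order_refl] by (meson not_le_imp_less)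
  have "continuous_on {u..s} h"
    using s u by (intro continuous_on_subset[OF cont]) auto
  then obtain b where b: "b \<in> {u..s}" "h b = \<kappa>" "\<And>s. s \<in> {u..b} \<Longrightarrow> \<kappa> \<le> h s"
    using first_time_below[of u s h \<kappa>] s \<open>\<kappa> \<le> h u\<close> by (metis atLeastAtMost_iff less_imp_le)
  have "b - a \<le> 4 * \<kappa>"
    using length[of b, OF _ _ b(3)] b(1,2) s(1) by simp
  \<comment> \<open>The average of these bounds is \<open>\<kappa> + (b - a) / 2\<close>, at most
    \<open>3 * \<kappa>\<close>.\<close>
  moreover have "h u \<le> h a + (u - a)" "h u \<le> h b + (b - u)"
    using infdist_triangle[of "\<gamma> u" Z "\<gamma> a"] infdist_triangle[of "\<gamma> u" Z "\<gamma> b"] \<gamma> a(1) b(1) s(1) u(1)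
    by (auto simp: h_def geodesic_def)
  ultimately show False
    using a(1,2) b(1,2) hu \<kappa>(1) by simp
qed

text \<open>Points of the ray within distance 1 of \<open>x\<close> have parameter at most
  \<open>T\<close>, so a limit point \<open>x\<close> already lies in the closure of a compact
  initial arc.\<close>

lemma geodesic_ray_closed:
  fixes \<gamma> :: "real \<Rightarrow> 'a::metric_space"
  assumes \<gamma>: "geodesic {0..} \<gamma>"
  shows "closed (ray_image \<gamma>)"
proof -
  have "x \<in> ray_image \<gamma>" if x: "x \<in> closure (ray_image \<gamma>)" for x
  proof -
    define T where "T = dist (\<gamma> 0) x + 1"
    have "x \<in> closure (\<gamma> ` {0..T})"
      unfolding closure_approachable
    proof (intro allI impI)
      fix e :: real assume "e > 0"
      then have "min e 1 > 0" by simp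
      then obtain t where t: "t \<ge> 0" "dist (\<gamma> t) x < min e 1"
        using x unfolding closure_approachable by (metis atLeast_iff imageE)
      then have "t \<le> T"
        using dist_triangle[of "\<gamma> 0" "\<gamma> t" x] \<gamma> by (auto simp: T_def geodesic_def dist_commute)
      with t show "\<exists>y\<in>\<gamma> ` {0..T}. dist y x < e" by auto
    qed
    moreover have "compact (\<gamma> ` {0..T})"
      by (intro compact_continuous_image continuous_on_subset[OF geodesic_continuous_on[OF \<gamma>]]) auto
    ultimately have "x \<in> \<gamma> ` {0..T}"
      using compact_imp_closed closure_closed by blast
    then show ?thesis by auto
  qed
  then show ?thesis
    using closure_subset_eq by blast
qed

text \<open>The common starting point forces the parameters \<open>u\<close> and \<open>t\<close> to
  differ by at most \<open>C\<close>.\<close>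

lemma dist_rays_le:
  assumes \<gamma>: "geodesic I \<gamma>" "0 \<in> I" "u \<in> I" "u \<ge> 0"
    and \<alpha>: "geodesic {0..} \<alpha>" "\<gamma> 0 = \<alpha> 0"
    and z: "dist (\<gamma> u) (\<alpha> t) \<le> C" "t \<ge> 0"
  shows "dist (\<gamma> u) (\<alpha> u) \<le> 2 * C"
proof -
  have "dist (\<gamma> 0) (\<gamma> u) = u" "dist (\<alpha> 0) (\<alpha> t) = t" "dist (\<alpha> t) (\<alpha> u) = \<bar>t - u\<bar>"
    using assms unfolding geodesic_def by auto
  moreover have "dist (\<gamma> 0) (\<gamma> u) \<le> dist (\<gamma> 0) (\<alpha> t) + dist (\<gamma> u) (\<alpha> t)"
    "dist (\<alpha> 0) (\<alpha> t) \<le> dist (\<alpha> 0) (\<gamma> u) + dist (\<gamma> u) (\<alpha> t)"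
    "dist (\<gamma> u) (\<alpha> u) \<le> dist (\<gamma> u) (\<alpha> t) + dist (\<alpha> t) (\<alpha> u)"
    by (metis dist_commute dist_triangle)+
  ultimately show ?thesis using assms(6-7) by (auto simp: abs_if split: if_splits)
qed

text \<open>Stated for segments, because a geodesic will only be known to be near
  \<open>\<alpha>\<close> at a single far point; up to a definite margin before that point it must
  follow \<open>\<alpha>\<close>, with a constant depending on \<open>\<alpha>\<close>
  alone.\<close>

lemma contracting_ray_shadows:
  fixes \<alpha> :: "real \<Rightarrow> 'a::heine_borel"
  assumes \<alpha>: "geodesic {0..} \<alpha>" "contracting (ray_image \<alpha>)"
  obtains C where "C > 0"
    "\<And>\<gamma> T u. geodesic {0..T} \<gamma> \<Longrightarrow> \<gamma> 0 = \<alpha> 0 \<Longrightarrow> 0 \<le> u \<Longrightarrow>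
       u + C + 2 * infdist (\<gamma> T) (ray_image \<alpha>) < T \<Longrightarrow> dist (\<gamma> u) (\<alpha> u) \<le> C"
proof -
  let ?Z = "ray_image \<alpha>"
  obtain \<rho> where \<rho>: "closed ?Z" "sublinear \<rho>" "rho_contracting \<rho> ?Z"
    using \<alpha>(2) unfolding contracting_def by blast
  obtain \<kappa> where \<kappa>: "\<kappa> > 0" "\<And>r. r \<ge> \<kappa> \<Longrightarrow> \<rho> r \<le> r / 8"
  proof -
    have "\<exists>\<kappa>>0. \<forall>r\<ge>\<kappa>. \<rho> r \<le> r / 8"
      using sublinear_eventually_le[OF \<rho>(2), of "1 / 8"] by simp
    with that show thesis by blast
  qed
  show thesis
  \<comment> \<open>Distance \<open>5 * \<kappa>\<close> to the image doubles when parameters are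
    matched; the same constant covers the margin \<open>2 * \<kappa>\<close>.\<close>
  proof (rule that[of "10 * \<kappa>"])
    fix \<gamma> :: "real \<Rightarrow> 'a" and T u
    assume \<gamma>: "geodesic {0..T} \<gamma>" "\<gamma> 0 = \<alpha> 0"
      and u: "0 \<le> u" "u + 10 * \<kappa> + 2 * infdist (\<gamma> T) ?Z < T"
    have "infdist (\<gamma> u) ?Z \<le> 5 * \<kappa>"
      by (rule geodesic_near_contracting_set[OF \<rho>(1) _ \<rho>(3) \<kappa> \<gamma>(1)]) (use u \<kappa>(1) \<gamma>(2) in simp_all)
    moreover obtain z where "z \<in> ?Z" "infdist (\<gamma> u) ?Z = dist (\<gamma> u) z"
      by (rule infdist_attains_inf[OF \<rho>(1), of "\<gamma> u"]) auto
    moreover from this obtain t where "t \<ge> 0" "z = \<alpha> t" by auto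
    ultimately have "dist (\<gamma> u) (\<alpha> t) \<le> 5 * \<kappa>" by simp
    from dist_rays_le[OF \<gamma>(1) _ _ u(1) \<alpha>(1) \<gamma>(2) this \<open>t \<ge> 0\<close>]
    show "dist (\<gamma> u) (\<alpha> u) \<le> 10 * \<kappa>"
      using u \<kappa>(1) infdist_nonneg[of "\<gamma> T" ?Z] by simp
  qed (use \<kappa> in auto)
qed

section \<open>Stability of contraction under finite Hausdorff distance\<close>

text \<open>Sublinear functions are nonnegative only eventually; truncation makes it harmless to add
  extra values of \<open>\<rho>\<close> to an upper bound.\<close>

lemma sublinear_max_zero:
  assumes "sublinear \<rho>"
  shows "sublinear (\<lambda>r. max (\<rho> r) 0)"
proof -
  have "((\<lambda>r. max (\<rho> r / r) 0) \<longlongrightarrow> max 0 0) at_top"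
    using assms unfolding sublinear_def by (intro tendsto_max) auto
  moreover have "\<forall>\<^sub>F r in at_top. max (\<rho> r / r) 0 = max (\<rho> r) 0 / r"
    using eventually_gt_at_top[of 0] by eventually_elim (simp add: max_def field_simps)
  ultimately have "((\<lambda>r. max (\<rho> r) 0 / r) \<longlongrightarrow> 0) at_top"
    using tendsto_cong by force
  moreover have "mono_on {0..} (\<lambda>r. max (\<rho> r) 0)"
  proof (intro mono_onI max.mono order_refl)
    fix r s :: real assume "r \<in> {0..}" "s \<in> {0..}" "r \<le> s"
    with assms show "\<rho> r \<le> \<rho> s"
      unfolding sublinear_def using mono_onD by blast
  qed
  ultimately show ?thesis by (simp add: sublinear_def)
qed

lemma sublinear_affine_compose:
  assumes \<rho>: "sublinear \<rho>" "\<And>r. \<rho> r \<ge> 0" and "a > 0" "b \<ge> 0" "c \<ge> 0" "d \<ge> 0"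
  shows "sublinear (\<lambda>r. d + c * \<rho> (a * r + b))"
proof -
  have mono: "mono_on {0..} \<rho>" and lim: "((\<lambda>r. \<rho> r / r) \<longlongrightarrow> 0) at_top"
    using \<rho> by (simp_all add: sublinear_def)
  have "filterlim (\<lambda>r. a * r + b) at_top at_top"
    using \<open>a > 0\<close> by real_asymp
  from filterlim_compose[OF lim this]
  have "((\<lambda>r. \<rho> (a * r + b) / (a * r + b)) \<longlongrightarrow> 0) at_top" .
  moreover have "((\<lambda>r. (a * r + b) / r) \<longlongrightarrow> a) at_top" "((\<lambda>r. d / r) \<longlongrightarrow> 0) at_top"
    by real_asymp+
  \<comment> \<open>The quotient by \<open>r\<close> is factored through \<open>a * r + b\<close>,
    where sublinearity of \<open>\<rho>\<close> applies.\<close>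
  ultimately have "((\<lambda>r. d / r + c * ((\<rho> (a * r + b) / (a * r + b)) * ((a * r + b) / r)))
      \<longlongrightarrow> 0 + c * (0 * a)) at_top"
    by (intro tendsto_intros)
  moreover have "\<forall>\<^sub>F r in at_top.
      d / r + c * ((\<rho> (a * r + b) / (a * r + b)) * ((a * r + b) / r)) =
      (d + c * \<rho> (a * r + b)) / r"
    using eventually_gt_at_top[of 0]
  proof eventually_elim
    case (elim r)
    then have "a * r + b \<noteq> 0" using assms(3,4) by (smt (verit) mult_pos_pos)
    then have "\<rho> (a * r + b) / (a * r + b) * ((a * r + b) / r) = \<rho> (a * r + b) / r"
      by simp
    then show ?case by (simp add: add_divide_distrib)
  qed
  ultimately have "((\<lambda>r. (d + c * \<rho> (a * r + b)) / r) \<longlongrightarrow> 0) at_top"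
    using tendsto_cong by force
  moreover have "mono_on {0..} (\<lambda>r. d + c * \<rho> (a * r + b))"
    using assms by (intro mono_onI add_left_mono mult_left_mono mono_onD[OF mono]) auto
  ultimately show ?thesis
    using assms by (simp add: sublinear_def)
qed

lemma geodesic_space_point:
  fixes x y :: "'a::metric_space"
  assumes "geodesic_space TYPE('a)" "0 \<le> t" "t \<le> dist x y"
  obtains w :: 'a where "dist x w = t" "dist w y = dist x y - t"
proof -
  obtain \<gamma> where \<gamma>: "geodesic {0..dist x y} \<gamma>" "\<gamma> 0 = x" "\<gamma> (dist x y) = y"
    using assms(1) unfolding geodesic_space_def by blast
  have "dist (\<gamma> 0) (\<gamma> t) = t" "dist (\<gamma> t) (\<gamma> (dist x y)) = dist x y - t"
    using \<gamma>(1) assms(2,3) unfolding geodesic_def by auto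
  with \<gamma>(2,3) that show thesis by simp
qed

lemma infdist_le_add:
  fixes x :: "'a::heine_borel"
  assumes "closed Y" "Y \<noteq> {}" "\<And>a. a \<in> Y \<Longrightarrow> \<exists>z\<in>Z. dist a z \<le> C"
  shows "infdist x Z \<le> infdist x Y + C"
proof -
  obtain a where a: "a \<in> Y" "infdist x Y = dist x a"
    by (rule infdist_attains_inf[OF assms(1,2)])
  with assms(3) obtain z where "z \<in> Z" "dist a z \<le> C" by blast
  then show ?thesis
    using infdist_le[of z Z x] dist_triangle[of x z a] a(2) by simp
qed

text \<open>On a geodesic from \<open>x\<close> to \<open>z\<close>, the point \<open>w\<close> at
  distance \<open>infdist x Z\<close> from \<open>x\<close> is within \<open>D\<close> of
  \<open>z\<close>, hence within \<open>2 * D\<close> of \<open>z\<close> after projection;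
  contraction compares the projections of \<open>x\<close> and \<open>w\<close>.\<close>

lemma almost_closest_point_near_projection:
  fixes x :: "'a::heine_borel"
  assumes X: "geodesic_space TYPE('a)" and Z: "closed Z" "rho_contracting \<rho> Z"
    and z: "z \<in> Z" "dist x z \<le> infdist x Z + D" and u: "u \<in> closest_points Z x"
  shows "dist z u \<le> 2 * D + \<rho> (infdist x Z)"
proof -
  obtain w where w: "dist x w = infdist x Z" "dist w z = dist x z - infdist x Z"
    using geodesic_space_point[OF X infdist_nonneg infdist_le[OF z(1)]] .
  have "Z \<noteq> {}" using z(1) by blast
  then obtain v where v: "v \<in> closest_points Z w"
    using closest_points_nonempty[OF Z(1)] by blast
  have "dist u v \<le> \<rho> (infdist x Z)"
    using rho_contractingD[OF Z(2) _ u v] w(1) by simp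
  moreover have "dist w v \<le> dist w z"
    using v infdist_le[OF z(1), of w] by (simp add: closest_points_def)
  ultimately show ?thesis
    using w(2) z(2) dist_triangle[of z u v] dist_triangle[of z v w] by (simp add: dist_commute)
qed

text \<open>Relaxes the ball condition by \<open>C\<close>. A point \<open>w\<close> between
  \<open>x\<close> and \<open>y\<close> satisfies the condition for \<open>x\<close> and is within
  \<open>C\<close> of \<open>y\<close>. Either it also satisfies the condition for \<open>y\<close>,
  or \<open>y\<close> is so close to \<open>Z\<close> that the projections of \<open>y\<close> and
  \<open>w\<close> are near by the triangle inequality.\<close>

lemma projections_of_nearby_points:
  fixes x y :: "'a::heine_borel"
  assumes X: "geodesic_space TYPE('a)" and Z: "closed Z" "Z \<noteq> {}" "rho_contracting \<rho> Z"
    and nonneg: "\<And>r. \<rho> r \<ge> 0" and "C \<ge> 0" and xy: "dist x y \<le> infdist x Z + C"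
    and u: "u \<in> closest_points Z x" and v: "v \<in> closest_points Z y"
  shows "dist u v \<le> \<rho> (infdist x Z) + \<rho> (infdist y Z) + 4 * C"
proof -
  obtain w where w: "dist x w = min (infdist x Z) (dist x y)"
      "dist w y = dist x y - min (infdist x Z) (dist x y)"
    by (rule geodesic_space_point[OF X, of "min (infdist x Z) (dist x y)" x y])
      (auto simp: infdist_nonneg)
  have wy: "dist w y \<le> C" using w(2) xy \<open>C \<ge> 0\<close> by simp
  obtain q where q: "q \<in> closest_points Z w"
    using closest_points_nonempty[OF Z(1,2)] by blast
  have "dist u q \<le> \<rho> (infdist x Z)"
    using rho_contractingD[OF Z(3) _ u q] w(1) by simp
  moreover have "dist v q \<le> \<rho> (infdist y Z) + 4 * C"
  proof (cases "dist y w \<le> infdist y Z")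
    case True
    then show ?thesis
      using rho_contractingD[OF Z(3) True v q] \<open>C \<ge> 0\<close> by simp
  next
    case False
    have "dist v q \<le> dist y v + dist w y + dist w q"
      using dist_triangle[of v q y] dist_triangle[of y q w] by (simp add: dist_commute)
    also have "\<dots> = infdist y Z + dist w y + infdist w Z"
      using v q by (simp add: closest_points_def)
    also have "\<dots> \<le> 4 * C"
      using False wy infdist_triangle[of w Z y] by (simp add: dist_commute)
    finally show ?thesis using nonneg[of "infdist y Z"] by simp
  qed
  ultimately show ?thesis
    using dist_triangle[of u v q] by (simp add: dist_commute)
qed

lemma diameter_le_bound:
  assumes "0 \<le> \<delta>" "\<And>x y. x \<in> S \<Longrightarrow> y \<in> S \<Longrightarrow> dist x y \<le> \<delta>"
  shows "diameter S \<le> \<delta>"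
  using assms by (auto simp: diameter_def intro!: cSUP_least)

text \<open>A closest point in \<open>Y\<close> is almost closest in \<open>Z\<close> after a shift
  by \<open>C\<close>, so projections to \<open>Y\<close> and to \<open>Z\<close> stay near each
  other and the contraction of \<open>Z\<close> carries over.\<close>

lemma contracting_if_finite_Hausdorff_distance:
  fixes Y Z :: "'a::heine_borel set"
  assumes X: "geodesic_space TYPE('a)" and "contracting Z" "Z \<noteq> {}" "closed Y" "Y \<noteq> {}"
    and "finite_Hausdorff_distance Y Z"
  shows "contracting Y"
proof -
  obtain \<rho>0 where \<rho>0: "closed Z" "sublinear \<rho>0" "rho_contracting \<rho>0 Z"
    using \<open>contracting Z\<close> unfolding contracting_def by blast
  define \<rho> where "\<rho> r = max (\<rho>0 r) 0" for r
  have nonneg: "\<rho> r \<ge> 0" for r by (simp add: \<rho>_def)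
  have sub: "sublinear \<rho>" using sublinear_max_zero[OF \<rho>0(2)] by (simp add: \<rho>_def[abs_def])
  then have mono: "\<rho> r \<le> \<rho> s" if "0 \<le> r" "r \<le> s" for r s
    using that by (auto simp: sublinear_def intro: mono_onD)
  have con: "rho_contracting \<rho> Z"
    using \<rho>0(3) unfolding rho_contracting_def \<rho>_def by (meson max.coboundedI1)
  obtain C where C: "\<And>a. a \<in> Y \<Longrightarrow> \<exists>z\<in>Z. dist a z \<le> C" "\<And>z. z \<in> Z \<Longrightarrow> \<exists>a\<in>Y. dist z a \<le> C"
    using assms(6) unfolding finite_Hausdorff_distance_def by blast
  have "C \<ge> 0" using C(1) \<open>Y \<noteq> {}\<close> by (meson all_not_in_conv order_trans zero_le_dist)
  have YZ: "infdist x Z \<le> infdist x Y + C" "infdist x Y \<le> infdist x Z + C" for x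
    using infdist_le_add[OF assms(4,5) C(1)] infdist_le_add[OF \<rho>0(1) assms(3) C(2)] by blast+
  have proj: "dist a u \<le> 5 * C + \<rho> (infdist x Z)"
    if "a \<in> closest_points Y x" "u \<in> closest_points Z x" for a u x
  proof -
    have a: "a \<in> Y" "dist x a = infdist x Y" using that(1) by (simp_all add: closest_points_def)
    obtain z where z: "z \<in> Z" "dist a z \<le> C" using C(1) a(1) by blast
    \<comment> \<open>One \<open>C\<close> is the distance from \<open>a\<close> to
      \<open>z\<close>, the other comes from exchanging \<open>Y\<close> for
      \<open>Z\<close>.\<close>
    then have "dist x z \<le> infdist x Z + 2 * C"
      using dist_triangle[of x z a] a(2) YZ(2)[of x] by simp
    from almost_closest_point_near_projection[OF X \<rho>0(1) con z(1) this that(2)]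
    show ?thesis using dist_triangle[of a u z] z(2) by simp
  qed
  \<comment> \<open>Two uses of \<open>proj\<close> give \<open>10 * C\<close> and two values of
    \<open>\<rho>\<close>; comparing the projections to \<open>Z\<close> gives \<open>4 * C\<close>
    and two more. The argument is \<open>2 * r + C\<close> because \<open>y\<close> may be twice as
    far from \<open>Y\<close> as \<open>x\<close>, and passing to \<open>Z\<close> adds
    \<open>C\<close>.\<close>
  let ?\<rho> = "\<lambda>r. 14 * C + 4 * \<rho> (2 * r + C)"
  have bound: "dist a b \<le> 14 * C + 4 * \<rho> (R + C)"
    if xy: "dist x y \<le> infdist x Y" and R: "infdist x Y \<le> R" "infdist y Y \<le> R"
      and a: "a \<in> closest_points Y x" and b: "b \<in> closest_points Y y" for a b x y R
  proof -
    obtain u v where uv: "u \<in> closest_points Z x" "v \<in> closest_points Z y"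
      using closest_points_nonempty[OF \<rho>0(1) assms(3)] by metis
    have "dist a b \<le> dist a u + dist u v + dist b v"
      using dist_triangle[of a b u] dist_triangle[of u b v] by (simp add: dist_commute)
    moreover have "dist x y \<le> infdist x Z + C"
      using xy YZ(2)[of x] by simp
    note projections_of_nearby_points[OF X \<rho>0(1) assms(3) con nonneg \<open>C \<ge> 0\<close> this uv]
    moreover have "\<rho> (infdist x Z) \<le> \<rho> (R + C)" "\<rho> (infdist y Z) \<le> \<rho> (R + C)"
      using YZ(1)[of x] YZ(1)[of y] R by (auto intro!: mono infdist_nonneg)
    ultimately show ?thesis
      using proj[OF a uv(1)] proj[OF b uv(2)] by simp
  qed
  have "rho_contracting ?\<rho> Y"
    unfolding rho_contracting_def
  proof (intro allI impI)
    fix x y :: 'a assume xy: "dist x y \<le> infdist x Y"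
    show "diameter (closest_points Y x \<union> closest_points Y y) \<le> ?\<rho> (infdist x Y)"
    proof (rule diameter_le_bound)
      show "0 \<le> ?\<rho> (infdist x Y)" using nonneg \<open>C \<ge> 0\<close> by simp
    next
      let ?R = "2 * infdist x Y"
      have R: "infdist x Y \<le> ?R" "infdist y Y \<le> ?R"
        using infdist_nonneg[of x Y] infdist_triangle[of y Y x] xy by (simp_all add: dist_commute)
      \<comment> \<open>The diameter also involves two closest points of the same point; these are
        handled by the trivial pairs.\<close>
      have xx: "dist x x \<le> infdist x Y" "dist y y \<le> infdist y Y"
        by (simp_all add: infdist_nonneg)
      fix a b assume "a \<in> closest_points Y x \<union> closest_points Y y"
        "b \<in> closest_points Y x \<union> closest_points Y y"
      then consider "a \<in> closest_points Y x" "b \<in> closest_points Y x"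
        | "a \<in> closest_points Y x" "b \<in> closest_points Y y"
        | "a \<in> closest_points Y y" "b \<in> closest_points Y x"
        | "a \<in> closest_points Y y" "b \<in> closest_points Y y"
        by blast
      then show "dist a b \<le> ?\<rho> (infdist x Y)"
      proof cases
        case 1 then show ?thesis by (rule bound[OF xx(1) R(1,1)])
      next
        case 2 then show ?thesis by (rule bound[OF xy R])
      next
        case 3 then show ?thesis using bound[OF xy R, of b a] by (simp add: dist_commute)
      next
        case 4 then show ?thesis by (rule bound[OF xx(2) R(2,2)])
      qed
    qed
  qed
  moreover have "sublinear ?\<rho>"
    using \<open>C \<ge> 0\<close> by (intro sublinear_affine_compose sub nonneg) auto
  ultimately show ?thesis
    unfolding contracting_def using \<open>closed Y\<close> by blast
qed

section \<open>Geodesic rays in boundary classes\<close>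

lemma geodesic_ray_dist_start:
  assumes "geodesic {0..} \<gamma>" "\<gamma> 0 = p" "t \<ge> 0"
  shows "dist (\<gamma> t) p = t"
proof -
  have "dist (\<gamma> t) (\<gamma> 0) = \<bar>t - 0\<bar>" using assms(1,3) unfolding geodesic_def by simp
  with assms(2,3) show ?thesis by simp
qed

lemma finite_Hausdorff_distance_rays:
  assumes \<alpha>: "\<And>u. u \<ge> 0 \<Longrightarrow> dist (\<gamma> u) (\<alpha> u) \<le> C"
  shows "finite_Hausdorff_distance (ray_image \<alpha>) (ray_image \<gamma>)"
  unfolding finite_Hausdorff_distance_def using \<alpha> by (auto simp: dist_commute)

lemma geodesic_imp_quasi_geodesic: "geodesic I \<gamma> \<Longrightarrow> quasi_geodesic 1 0 I \<gamma>"
  by (simp add: geodesic_def quasi_geodesic_def)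

lemma geodesic_choiceD:
  assumes "geodesic_choice p \<alpha>" "\<zeta> \<in> contracting_boundary p"
  shows "\<alpha> \<zeta> \<in> \<zeta>" "geodesic {0..} (\<alpha> \<zeta>)" "\<alpha> \<zeta> 0 = p" "contracting (ray_image (\<alpha> \<zeta>))"
proof -
  show "\<alpha> \<zeta> \<in> \<zeta>" "geodesic {0..} (\<alpha> \<zeta>)"
    using assms unfolding geodesic_choice_def by blast+
  then have "\<alpha> \<zeta> \<in> contracting_rays p"
    using assms(2) in_quotient_imp_subset[OF equiv_asymptotic_rel]
    unfolding contracting_boundary_def by blast
  then show "\<alpha> \<zeta> 0 = p" "contracting (ray_image (\<alpha> \<zeta>))"
    by (simp_all add: contracting_rays_def)
qed

lemma same_class_if_asymptotic:
  assumes "\<zeta> \<in> contracting_boundary p" "\<eta> \<in> contracting_boundary p" "\<alpha> \<in> \<zeta>" "\<beta> \<in> \<eta>"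
    and "finite_Hausdorff_distance (ray_image \<alpha>) (ray_image \<beta>)"
  shows "\<zeta> = \<eta>"
proof -
  have "\<alpha> \<in> contracting_rays p" "\<beta> \<in> contracting_rays p"
    using assms(1-4) in_quotient_imp_subset[OF equiv_asymptotic_rel]
    unfolding contracting_boundary_def by blast+
  with assms(5) have "(\<alpha>, \<beta>) \<in> asymptotic_rel p" by (simp add: asymptotic_rel_def)
  with assms(1-4) show ?thesis
    unfolding contracting_boundary_def
    by (metis quotient_eqI[OF equiv_asymptotic_rel])
qed

lemma finite_Hausdorff_distance_in_class:
  assumes "\<zeta> \<in> contracting_boundary p" "\<alpha> \<in> \<zeta>" "\<beta> \<in> \<zeta>"
  shows "finite_Hausdorff_distance (ray_image \<alpha>) (ray_image \<beta>)"
  using in_quotient_imp_in_rel[OF equiv_asymptotic_rel, of \<zeta> p \<alpha> \<beta>] assms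
  by (auto simp: contracting_boundary_def asymptotic_rel_def)

text \<open>Classes consist of contracting rays, so contraction of \<open>\<gamma>\<close> must
  first be inherited from \<open>\<alpha>\<close>.\<close>

lemma shadowing_geodesic_ray_in_class:
  fixes \<gamma> :: "real \<Rightarrow> 'a::heine_borel"
  assumes X: "geodesic_space TYPE('a)" and \<zeta>: "\<zeta> \<in> contracting_boundary p" "\<alpha> \<in> \<zeta>"
    and \<gamma>: "geodesic {0..} \<gamma>" "\<gamma> 0 = p" and C: "\<And>u. u \<ge> 0 \<Longrightarrow> dist (\<gamma> u) (\<alpha> u) \<le> C"
  shows "\<gamma> \<in> \<zeta>"
proof -
  have fin: "finite_Hausdorff_distance (ray_image \<alpha>) (ray_image \<gamma>)"
    using C by (rule finite_Hausdorff_distance_rays)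
  have \<alpha>: "\<alpha> \<in> contracting_rays p"
    using \<zeta> in_quotient_imp_subset[OF equiv_asymptotic_rel]
    unfolding contracting_boundary_def by blast
  have "contracting (ray_image \<gamma>)"
  proof (rule contracting_if_finite_Hausdorff_distance[OF X])
    show "contracting (ray_image \<alpha>)" using \<alpha> by (simp add: contracting_rays_def)
    show "finite_Hausdorff_distance (ray_image \<gamma>) (ray_image \<alpha>)"
      using fin by (auto simp: finite_Hausdorff_distance_def)
  qed (use geodesic_ray_closed[OF \<gamma>(1)] in auto)
  then have "\<gamma> \<in> contracting_rays p"
    using \<gamma> geodesic_imp_quasi_geodesic by (auto simp: contracting_rays_def)
  with fin \<alpha> have "(\<alpha>, \<gamma>) \<in> asymptotic_rel p" by (simp add: asymptotic_rel_def)
  with \<zeta> show ?thesis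
    unfolding contracting_boundary_def
    by (meson in_quotient_imp_closed[OF equiv_asymptotic_rel])
qed

text \<open>Tychonoff's theorem in the topology of pointwise convergence: all conditions on the ray
  are closed conditions on finitely many coordinates at a time, so the finite intersection property
  yields one ray satisfying them for all \<open>n\<close>.\<close>

lemma geodesic_rays_compactness:
  fixes p :: "'a::heine_borel"
  assumes closed: "closed K" "\<And>t. closed (A t)"
    and ex: "\<And>n::nat. \<exists>\<gamma>. geodesic {0..} \<gamma> \<and> \<gamma> 0 = p \<and> \<gamma> ` {0..} \<subseteq> K \<and>
      (\<forall>t\<in>{0..real n}. \<gamma> t \<in> A t)"
  shows "\<exists>\<gamma>. geodesic {0..} \<gamma> \<and> \<gamma> 0 = p \<and> \<gamma> ` {0..} \<subseteq> K \<and> (\<forall>t\<ge>0. \<gamma> t \<in> A t)"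
proof -
  define S where "S = (\<Pi>\<^sub>E t\<in>UNIV. cball p \<bar>t\<bar>)"
  define F where "F n = {\<gamma>. (\<forall>s\<ge>0. \<forall>t\<ge>0. dist (\<gamma> s) (\<gamma> t) = \<bar>s - t\<bar>) \<and> \<gamma> 0 = p \<and>
      (\<forall>t\<ge>0. \<gamma> t \<in> K) \<and> (\<forall>t\<ge>0. t \<le> real n \<longrightarrow> \<gamma> t \<in> A t)}" for n
  have F: "\<gamma> \<in> F n \<longleftrightarrow> geodesic {0..} \<gamma> \<and> \<gamma> 0 = p \<and> \<gamma> ` {0..} \<subseteq> K \<and>
      (\<forall>t\<in>{0..real n}. \<gamma> t \<in> A t)" for \<gamma> n
    by (auto simp: F_def geodesic_def is_interval_ci)
  have "compact S"
    using compactin_PiE[of "\<lambda>_. euclidean" UNIV "\<lambda>t. cball p \<bar>t\<bar>"]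
    by (simp add: S_def euclidean_product_topology)
  moreover have "closed (F n)" for n
  proof -
    have mem: "closed {\<gamma> :: real \<Rightarrow> 'a. \<gamma> t \<in> B}" if "closed B" for t B
      using closed_vimage[OF that continuous_on_product_coordinates[of t]] by (simp add: vimage_def)
    have "closed {\<gamma> :: real \<Rightarrow> 'a. dist (\<gamma> s) (\<gamma> t) = d}" for s t d
      by (intro closed_Collect_eq continuous_intros continuous_on_product_coordinates)
    moreover have "closed {\<gamma> :: real \<Rightarrow> 'a. \<gamma> 0 = p}"
      using mem[of "{p}" 0] by simp
    ultimately show ?thesis
      unfolding F_def
      by (intro closed_Collect_conj closed_Collect_all closed_Collect_imp mem closed) auto
  qed
  moreover have "S \<inter> (\<Inter>n\<in>I. F n) \<noteq> {}" if "finite I" for I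
  proof -
    \<comment> \<open>The sets \<open>F n\<close> decrease with \<open>n\<close>, so one index
      beyond all of \<open>I\<close> suffices.\<close>
    obtain N where N: "\<And>n. n \<in> I \<Longrightarrow> n \<le> N"
      using \<open>finite I\<close> unfolding finite_nat_set_iff_bounded_le by blast
    obtain \<gamma> where \<gamma>: "\<gamma> \<in> F N"
      using ex[of N] unfolding F[symmetric] by blast
    \<comment> \<open>Rays are total functions with arbitrary values at negative times; setting
      these to \<open>p\<close> puts the ray into the compact product \<open>S\<close>.\<close>
    define \<gamma>' where "\<gamma>' t = \<gamma> (max t 0)" for t
    have eq: "\<gamma>' t = \<gamma> t" if "t \<ge> 0" for t using that by (simp add: \<gamma>'_def)
    have "dist p (\<gamma>' t) \<le> \<bar>t\<bar>" for t
    proof -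
      have "dist (\<gamma> 0) (\<gamma> (max t 0)) = \<bar>0 - max t 0\<bar>" "\<gamma> 0 = p"
        using \<gamma> unfolding F_def by (blast intro: max.cobounded2 order_refl)+
      then show ?thesis by (simp add: \<gamma>'_def)
    qed
    then have "\<gamma>' \<in> S" by (simp add: S_def PiE_iff)
    moreover have "\<gamma>' \<in> F n" if "n \<in> I" for n
      using \<gamma> N[OF that] by (simp add: F_def eq)
    ultimately show ?thesis by blast
  qed
  ultimately have "S \<inter> (\<Inter>n\<in>UNIV. F n) \<noteq> {}"
    by (rule compact_imp_fip_image[of S UNIV F])
  then obtain \<gamma> where \<gamma>: "\<And>n. \<gamma> \<in> F n" by auto
  moreover have "\<gamma> t \<in> A t" if "t \<ge> 0" for t
  proof -
    obtain n where "t \<le> real n" using real_arch_simple by blast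
    with \<gamma>[of n] that show ?thesis by (simp add: F_def)
  qed
  moreover from \<gamma>[of 0] have "geodesic {0..} \<gamma>" "\<gamma> 0 = p" "\<gamma> ` {0..} \<subseteq> K"
    unfolding F by blast+
  ultimately show ?thesis by blast
qed

section \<open>Open sets of boundary points\<close>

lemma FQ_open_meeting:
  fixes p :: "'a::heine_borel"
  assumes X: "geodesic_space TYPE('a)" and \<alpha>: "geodesic_choice p \<alpha>" and "open W"
  shows "FQ_open p \<alpha> {\<eta> \<in> contracting_boundary p.
    \<forall>\<beta>\<in>\<eta>. geodesic {0..} \<beta> \<longrightarrow> ray_image \<beta> \<inter> W \<noteq> {}}" (is "FQ_open p \<alpha> ?V")
  unfolding FQ_open_def
proof (intro conjI ballI)
  show "?V \<subseteq> contracting_boundary p" by blast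
  fix \<eta> assume \<eta>V: "\<eta> \<in> ?V"
  then have \<eta>: "\<eta> \<in> contracting_boundary p" by blast
  note \<alpha>\<eta> = geodesic_choiceD[OF \<alpha> \<eta>]
  obtain C where C: "C > 0" "\<And>\<gamma> T u. geodesic {0..T} \<gamma> \<Longrightarrow> \<gamma> 0 = \<alpha> \<eta> 0 \<Longrightarrow> 0 \<le> u \<Longrightarrow>
      u + C + 2 * infdist (\<gamma> T) (ray_image (\<alpha> \<eta>)) < T \<Longrightarrow> dist (\<gamma> u) (\<alpha> \<eta> u) \<le> C"
    using contracting_ray_shadows[OF \<alpha>\<eta>(2,4)] by blast
  \<comment> \<open>Geodesics are the quasi-geodesics with constants 1 and 0. The added 1 makes the
    bound on \<open>setdist\<close> strict, so that it is witnessed by actual points.\<close>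
  define k where "k = max (kappa (rho_of \<eta>) 1 0 + 1) 0"
  show "\<exists>r\<ge>1. FQ_nbhd p \<alpha> \<eta> r \<subseteq> ?V"
  proof (rule ccontr)
    assume contra: "\<not> ?thesis"
    have "\<exists>\<gamma>. geodesic {0..} \<gamma> \<and> \<gamma> 0 = p \<and> \<gamma> ` {0..} \<subseteq> - W \<and>
      (\<forall>t\<in>{0..real n}. \<gamma> t \<in> cball (\<alpha> \<eta> t) C)" for n
    proof -
      \<comment> \<open>One \<open>k\<close> is lost in passing from the point of the tail to
        \<open>\<beta> s\<close>, two more enter the shadowing condition.\<close>
      define r where "r = real n + C + 3 * k + 1"
      have r: "r \<ge> 1" using C(1) by (simp add: r_def k_def)
      with contra obtain \<xi> where \<xi>: "\<xi> \<in> FQ_nbhd p \<alpha> \<eta> r" "\<xi> \<notin> ?V" by blast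
      then have \<xi>b: "\<xi> \<in> contracting_boundary p" by (simp add: FQ_nbhd_def)
      with \<xi>(2) obtain \<beta> where \<beta>: "\<beta> \<in> \<xi>" "geodesic {0..} \<beta>" "ray_image \<beta> \<inter> W = {}" by blast
      have \<beta>0: "\<beta> 0 = p" using based_at_basepoint[OF \<xi>b \<beta>(1)] .
      have "dist (\<alpha> \<eta> r) p = r"
        using geodesic_ray_dist_start[OF \<alpha>\<eta>(2,3)] r by simp
      \<comment> \<open>\<open>setdist\<close> to the empty set is 0, so a small value alone would
        not provide a point of the tail.\<close>
      then have ne: "{x \<in> ray_image (\<alpha> \<eta>). dist x p \<ge> r} \<noteq> {}"
        using r by (auto intro!: bexI[of _ r])
      have lt: "setdist (ray_image \<beta>) {x \<in> ray_image (\<alpha> \<eta>). dist x p \<ge> r} < k"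
      proof -
        have "setdist (ray_image \<beta>) {x \<in> ray_image (\<alpha> \<eta>). dist x p \<ge> r} \<le> kappa (rho_of \<eta>) 1 0"
          using \<xi>(1) \<beta>(1) geodesic_continuous_on[OF \<beta>(2)] geodesic_imp_quasi_geodesic[OF \<beta>(2)]
          unfolding FQ_nbhd_def by simp
        then show ?thesis by (simp add: k_def)
      qed
      obtain x y where x: "x \<in> ray_image \<beta>"
          and "y \<in> {x \<in> ray_image (\<alpha> \<eta>). dist x p \<ge> r}" and xy: "dist x y < k"
        by (rule setdist_ltE[OF lt _ ne]) auto
      then have y: "y \<in> ray_image (\<alpha> \<eta>)" "dist y p \<ge> r" by simp_all
      obtain s where s: "s \<ge> 0" "x = \<beta> s" using x by auto
      have "dist (\<beta> s) p = s"
        by (rule geodesic_ray_dist_start[OF \<beta>(2) \<beta>0 s(1)])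
      then have "s > r - k"
        using y(2) xy dist_triangle[of y p x] s(2) by (simp add: dist_commute)
      moreover have "infdist (\<beta> s) (ray_image (\<alpha> \<eta>)) \<le> k"
        using infdist_le[OF y(1), of x] xy s(2) by simp
      moreover have "geodesic {0..s} \<beta>"
        by (rule geodesic_subset[OF \<beta>(2)]) (auto simp: is_interval_cc)
      ultimately have "dist (\<beta> t) (\<alpha> \<eta> t) \<le> C" if "t \<in> {0..real n}" for t
        using that by (intro C(2)) (auto simp: \<beta>0 \<alpha>\<eta>(3) r_def)
      with \<beta> \<beta>0 show ?thesis by (intro exI[of _ \<beta>]) (auto simp: dist_commute)
    qed
    \<comment> \<open>The limit ray stays near \<open>\<alpha> \<eta>\<close> for all time and still
      misses \<open>W\<close>, whose complement is closed.\<close>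
    then obtain \<gamma> where \<gamma>: "geodesic {0..} \<gamma>" "\<gamma> 0 = p" "\<gamma> ` {0..} \<subseteq> - W"
        "\<And>t. t \<ge> 0 \<Longrightarrow> dist (\<gamma> t) (\<alpha> \<eta> t) \<le> C"
      using geodesic_rays_compactness[of "- W" "\<lambda>t. cball (\<alpha> \<eta> t) C" p] \<open>open W\<close>
      by (auto simp: dist_commute)
    have "\<gamma> \<in> \<eta>"
      using shadowing_geodesic_ray_in_class[OF X \<eta> \<alpha>\<eta>(1) \<gamma>(1,2,4)] .
    with \<eta>V \<gamma>(1,3) show False by blast
  qed
qed

theorem proposition5p12:
  fixes p :: "'a::heine_borel"
    and \<alpha> :: "(real \<Rightarrow> 'a) set \<Rightarrow> (real \<Rightarrow> 'a)"
  assumes "geodesic_space TYPE('a)"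
    and "geodesic_choice p \<alpha>"
  shows "Hausdorff_space (FQ_topology p \<alpha>)"
  unfolding Hausdorff_space_def topspace_FQ_topology[OF assms(2)] openin_FQ_topology[OF assms(2)]
proof (intro allI impI, elim conjE)
  have shadow: "\<exists>C>0. \<forall>\<gamma> T u. geodesic {0..T} \<gamma> \<and> \<gamma> 0 = p \<and> 0 \<le> u \<and>
      u + C + 2 * infdist (\<gamma> T) (ray_image (\<alpha> \<zeta>)) < T \<longrightarrow> dist (\<gamma> u) (\<alpha> \<zeta> u) \<le> C"
    if "\<zeta> \<in> contracting_boundary p" for \<zeta>
    using contracting_ray_shadows[OF geodesic_choiceD(2,4)[OF assms(2) that]]
      geodesic_choiceD(3)[OF assms(2) that] by metis
  \<comment> \<open>The radius exceeds \<open>C\<close>, so the open balls contain every point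
    within the shadowing distance of the tail.\<close>
  define W where "W \<zeta> C r = (\<Union>t\<in>{r..}. ball (\<alpha> \<zeta> t) (C + 1))" for \<zeta> C r
  define V where "V \<zeta> C r = {\<eta> \<in> contracting_boundary p.
    \<forall>\<beta>\<in>\<eta>. geodesic {0..} \<beta> \<longrightarrow> ray_image \<beta> \<inter> W \<zeta> C r \<noteq> {}}" for \<zeta> C r
  have V_open: "FQ_open p \<alpha> (V \<zeta> C r)" for \<zeta> C r
    unfolding V_def by (intro FQ_open_meeting assms) (simp add: W_def open_UN)
  have self: "\<zeta> \<in> V \<zeta> C r"
    if \<zeta>: "\<zeta> \<in> contracting_boundary p" and "r \<ge> 0"
      and C: "\<forall>\<gamma> T u. geodesic {0..T} \<gamma> \<and> \<gamma> 0 = p \<and> 0 \<le> u \<and>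
        u + C + 2 * infdist (\<gamma> T) (ray_image (\<alpha> \<zeta>)) < T \<longrightarrow> dist (\<gamma> u) (\<alpha> \<zeta> u) \<le> C"
    for \<zeta> C r
  proof -
    have "ray_image \<beta> \<inter> W \<zeta> C r \<noteq> {}" if \<beta>: "\<beta> \<in> \<zeta>" "geodesic {0..} \<beta>" for \<beta>
    proof -
      obtain D where D: "\<And>x. x \<in> ray_image \<beta> \<Longrightarrow> \<exists>y\<in>ray_image (\<alpha> \<zeta>). dist x y \<le> D"
        using finite_Hausdorff_distance_in_class[OF \<zeta> \<beta>(1) geodesic_choiceD(1)[OF assms(2) \<zeta>]]
        unfolding finite_Hausdorff_distance_def by blast
      \<comment> \<open>Far enough out for shadowing to hold at time \<open>r\<close>; here
        \<open>D\<close> may depend on \<open>\<beta>\<close>, whereas \<open>C\<close> does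
        not.\<close>
      define T where "T = max 0 (r + C + 2 * D + 1)"
      have "infdist (\<beta> T) (ray_image (\<alpha> \<zeta>)) \<le> D"
        using D[of "\<beta> T"] by (auto simp: T_def intro: infdist_le2)
      then have "r + C + 2 * infdist (\<beta> T) (ray_image (\<alpha> \<zeta>)) < T" by (simp add: T_def)
      moreover have "geodesic {0..T} \<beta>"
        by (rule geodesic_subset[OF \<beta>(2)]) (auto simp: is_interval_cc)
      ultimately have "dist (\<beta> r) (\<alpha> \<zeta> r) \<le> C"
        using C based_at_basepoint[OF \<zeta> \<beta>(1)] \<open>r \<ge> 0\<close> by blast
      then have "\<beta> r \<in> W \<zeta> C r"
        by (auto simp: W_def dist_commute intro!: bexI[of _ r])
      with \<open>r \<ge> 0\<close> show ?thesis by auto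
    qed
    with \<zeta> show ?thesis by (simp add: V_def)
  qed
  \<comment> \<open>Meeting the ball around \<open>\<alpha> \<zeta> t\<close> at time
    \<open>s\<close> costs \<open>C + 1\<close> in the estimate of \<open>s\<close> and
    \<open>2 * (C + 1)\<close> in the shadowing margin, which has a further \<open>C\<close>; the
    gap \<open>4 * C + 4\<close> covers all of it.\<close>
  have follow: "dist (\<beta> u) (\<alpha> \<zeta> u) \<le> C"
    if \<zeta>: "\<zeta> \<in> contracting_boundary p" and "C > 0"
      and C: "\<forall>\<gamma> T u. geodesic {0..T} \<gamma> \<and> \<gamma> 0 = p \<and> 0 \<le> u \<and>
        u + C + 2 * infdist (\<gamma> T) (ray_image (\<alpha> \<zeta>)) < T \<longrightarrow> dist (\<gamma> u) (\<alpha> \<zeta> u) \<le> C"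
      and \<beta>: "geodesic {0..} \<beta>" "\<beta> 0 = p" "ray_image \<beta> \<inter> W \<zeta> C r \<noteq> {}"
      and u: "u \<ge> 0" "u + 4 * C + 4 < r"
    for \<zeta> C r \<beta> u
  proof -
    obtain s t where st: "s \<ge> 0" "t \<ge> r" "dist (\<alpha> \<zeta> t) (\<beta> s) < C + 1"
      using \<beta>(3) by (auto simp: W_def)
    have "r \<ge> 0" using u \<open>C > 0\<close> by simp
    have "dist (\<beta> s) p = s" "dist (\<alpha> \<zeta> t) p = t"
      using \<beta>(1,2) geodesic_choiceD(2,3)[OF assms(2) \<zeta>] st(1,2) \<open>r \<ge> 0\<close>
      by (simp_all add: geodesic_ray_dist_start)
    then have "s > r - (C + 1)"
      using st(2,3) dist_triangle[of "\<alpha> \<zeta> t" p "\<beta> s"] by simp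
    moreover have "infdist (\<beta> s) (ray_image (\<alpha> \<zeta>)) \<le> C + 1"
      using st \<open>r \<ge> 0\<close> by (intro infdist_le2[of "\<alpha> \<zeta> t"]) (auto simp: dist_commute)
    ultimately have "u + C + 2 * infdist (\<beta> s) (ray_image (\<alpha> \<zeta>)) < s"
      using u(2) by simp
    moreover have "geodesic {0..s} \<beta>"
      by (rule geodesic_subset[OF \<beta>(1)]) (auto simp: is_interval_cc)
    ultimately show ?thesis using C \<beta>(2) u(1) by blast
  qed
  fix \<zeta> \<eta> assume \<zeta>: "\<zeta> \<in> contracting_boundary p" and \<eta>: "\<eta> \<in> contracting_boundary p" and "\<zeta> \<noteq> \<eta>"
  obtain C where C: "C > 0" "\<forall>\<gamma> T u. geodesic {0..T} \<gamma> \<and> \<gamma> 0 = p \<and> 0 \<le> u \<and>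
        u + C + 2 * infdist (\<gamma> T) (ray_image (\<alpha> \<zeta>)) < T \<longrightarrow> dist (\<gamma> u) (\<alpha> \<zeta> u) \<le> C"
    using shadow[OF \<zeta>] by blast
  obtain D where D: "D > 0" "\<forall>\<gamma> T u. geodesic {0..T} \<gamma> \<and> \<gamma> 0 = p \<and> 0 \<le> u \<and>
        u + D + 2 * infdist (\<gamma> T) (ray_image (\<alpha> \<eta>)) < T \<longrightarrow> dist (\<gamma> u) (\<alpha> \<eta> u) \<le> D"
    using shadow[OF \<eta>] by blast
  \<comment> \<open>Otherwise the representatives would be at finite Hausdorff distance and the
    classes equal.\<close>
  have "\<not> (\<forall>u\<ge>0. dist (\<alpha> \<zeta> u) (\<alpha> \<eta> u) \<le> C + D)"
    using same_class_if_asymptotic[OF \<eta> \<zeta> geodesic_choiceD(1)[OF assms(2) \<eta>]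
        geodesic_choiceD(1)[OF assms(2) \<zeta>]] finite_Hausdorff_distance_rays[of "\<alpha> \<zeta>" "\<alpha> \<eta>"]
      \<open>\<zeta> \<noteq> \<eta>\<close> by blast
  then obtain u where u: "u \<ge> 0" "dist (\<alpha> \<zeta> u) (\<alpha> \<eta> u) > C + D"
    by (auto simp: not_le)
  define r where "r = u + 4 * C + 4 * D + 5"
  have "V \<zeta> C r \<inter> V \<eta> D r = {}"
  proof (rule ccontr)
    assume "\<not> ?thesis"
    then obtain \<xi> where \<xi>: "\<xi> \<in> V \<zeta> C r" "\<xi> \<in> V \<eta> D r" by blast
    then have \<xi>b: "\<xi> \<in> contracting_boundary p" by (simp add: V_def)
    \<comment> \<open>The representative of a common class would follow both rays up to time
      \<open>u\<close>, where they are more than \<open>C + D\<close> apart.\<close>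
    note \<alpha>\<xi> = geodesic_choiceD[OF assms(2) \<xi>b]
    have "dist (\<alpha> \<xi> u) (\<alpha> \<zeta> u) \<le> C"
      using \<xi>(1) \<alpha>\<xi> u(1) D(1) by (intro follow[OF \<zeta> C, of _ r]) (auto simp: V_def r_def)
    moreover have "dist (\<alpha> \<xi> u) (\<alpha> \<eta> u) \<le> D"
      using \<xi>(2) \<alpha>\<xi> u(1) C(1) by (intro follow[OF \<eta> D, of _ r]) (auto simp: V_def r_def)
    ultimately show False
      using u(2) dist_triangle3[of "\<alpha> \<zeta> u" "\<alpha> \<eta> u" "\<alpha> \<xi> u"] by simp
  qed
  moreover have "r \<ge> 0" using u(1) C(1) D(1) by (simp add: r_def)
  ultimately show "\<exists>U V. FQ_open p \<alpha> U \<and> FQ_open p \<alpha> V \<and> \<zeta> \<in> U \<and> \<eta> \<in> V \<and> disjnt U V"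
    using V_open self[OF \<zeta> _ C(2)] self[OF \<eta> _ D(2)] unfolding disjnt_def by blast
qed

end
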